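(* Let $b_1,b_2,c_1,c_2,h_1,h_2$ be positive real numbers. If at least one of the following conditions is satisfied: (a) $1-b_1+h_1+c_1h_2\ge 0$ and $1-b_2+h_2+c_2h_1\ge 0$; (b) $c_1c_2\le 1$; then the system of difference equations $$x_{n+1}=\frac{b_1x_n}{1+x_n+c_1y_n}+h_1,\qquad y_{n+1}=\frac{b_2y_n}{1+y_n+c_2x_n}+h_2,\qquad n=0,1,\ldots,\quad (x_0,y_0)\in[0,\infty)^2,$$ has a unique equilibrium in $[0,\infty)^2$.
   Context: An equilibrium in $[0,\infty)^2$ is a point $(x,y)\in[0,\infty)^2$ with $x=\frac{b_1x}{1+x+c_1y}+h_1$ and $y=\frac{b_2y}{1+y+c_2x}+h_2$. *)

theory Defs
  imports "HOL-Analysis.Analysis"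
begin

definition equilibrium ::
    "real \<Rightarrow> real \<Rightarrow> real \<Rightarrow> real \<Rightarrow> real \<Rightarrow> real \<Rightarrow> real \<times> real \<Rightarrow> bool" where
  "equilibrium b1 b2 c1 c2 h1 h2 = (\<lambda>(x, y).
     (x, y) \<in> {0..} \<times> {0..} \<and>
     x = b1 * x / (1 + x + c1 * y) + h1 \<and>
     y = b2 * y / (1 + y + c2 * x) + h2)"

end

theory Submission
  imports Defs
begin

text \<open>
  Every equilibrium satisfies \<open>x > h1\<close> and \<open>y > h2\<close>. With \<open>u = x - h1\<close>, \<open>v = y - h2\<close> and
  \<open>A1 = 1 - b1 + h1 + c1 * h2\<close>, \<open>A2 = 1 - b2 + h2 + c2 * h1\<close>, the equilibria are the positive
  solutions of \<open>u\<^sup>2 + c1 u v + A1 u = b1 h1\<close>, \<open>v\<^sup>2 + c2 u v + A2 v = b2 h2\<close>.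
  For existence, solve the first equation for the positive root \<open>u\<close> as a
  continuous function of \<open>v\<close> and apply the intermediate value theorem to the second.
  For uniqueness, if \<open>u\<close> increases between two solutions, then \<open>v\<close> decreases. If \<open>A1\<close> and \<open>A2\<close> are
  nonnegative, the first equation makes the product \<open>u v\<close> decrease and the second makes it increase.
  If \<open>c1 c2 \<le> 1\<close>, divide the equations by \<open>u\<close> and \<open>v\<close>: the changes \<open>p\<close> of \<open>u\<close> and \<open>- q\<close> of \<open>v\<close>
  satisfy \<open>p < c1 q\<close> and \<open>q < c2 p\<close>, so \<open>p < c1 c2 p\<close>.
\<close>

definition shifted_equilibrium ::
    "real \<Rightarrow> real \<Rightarrow> real \<Rightarrow> real \<Rightarrow> real \<Rightarrow> real \<Rightarrow> real \<Rightarrow> real \<Rightarrow> bool" where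
  "shifted_equilibrium c1 c2 A1 A2 k1 k2 u v \<longleftrightarrow>
     u > 0 \<and> v > 0 \<and> u * (u + c1 * v + A1) = k1 \<and> v * (v + c2 * u + A2) = k2"

text \<open>Clearing the positive denominator gives the quadratic form. The terms in
  \<open>g\<close> cancel, so \<open>g\<close> is free and can serve as the shift of the other
  coordinate.\<close>

lemma coordinate_equation_iff:
  fixes b c h g x y :: real
  assumes "b > 0" "c > 0" "h > 0" "x \<ge> 0" "y \<ge> 0"
  shows "x = b * x / (1 + x + c * y) + h \<longleftrightarrow>
    x > h \<and> (x - h) * ((x - h) + c * (y - g) + (1 - b + h + c * g)) = b * h"
proof -
  let ?D = "1 + x + c * y"
  have D: "?D > 0"
    using assms by (simp add: add_pos_nonneg)
  have "x = b * x / ?D + h \<longleftrightarrow> (x - h) * ?D = b * x"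
    using D by (auto simp: field_simps)
  also have "\<dots> \<longleftrightarrow> (x - h) * ((x - h) + c * (y - g) + (1 - b + h + c * g)) = b * h"
    by (auto simp: algebra_simps)
  finally have eq: "x = b * x / ?D + h \<longleftrightarrow>
    (x - h) * ((x - h) + c * (y - g) + (1 - b + h + c * g)) = b * h" .
  have "x > h" if fixpoint: "x = b * x / ?D + h"
  proof -
    \<comment> \<open>Bootstrapping: a nonnegative quotient gives \<open>x \<ge> h > 0\<close>,
      which in turn makes the quotient strictly positive.\<close>
    have "b * x / ?D \<ge> 0"
      using D assms by simp
    then have "x > 0"
      using fixpoint assms(3) by linarith
    then have "b * x / ?D > 0"
      using D assms by simp
    then show ?thesis
      using fixpoint by linarith
  qed
  then show ?thesis
    using eq by blast
qed

lemma equilibrium_iff_shifted: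
  assumes "b1 > 0" "b2 > 0" "c1 > 0" "c2 > 0" "h1 > 0" "h2 > 0"
  shows "equilibrium b1 b2 c1 c2 h1 h2 (x, y) \<longleftrightarrow>
    shifted_equilibrium c1 c2 (1 - b1 + h1 + c1 * h2) (1 - b2 + h2 + c2 * h1)
      (b1 * h1) (b2 * h2) (x - h1) (y - h2)"
proof (cases "x \<ge> 0 \<and> y \<ge> 0")
  case True
  then show ?thesis
    using coordinate_equation_iff[of b1 c1 h1 x y h2] coordinate_equation_iff[of b2 c2 h2 y x h1] assms
    unfolding equilibrium_def shifted_equilibrium_def by auto
next
  \<comment> \<open>Outside the quadrant both sides fail, as the shifted form forces
    \<open>x > h1\<close> and \<open>y > h2\<close>.\<close>
  case False
  then show ?thesis
    using assms unfolding equilibrium_def shifted_equilibrium_def by auto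
qed

lemma shifted_equilibrium_exists:
  fixes c1 c2 A1 A2 k1 k2 :: real
  assumes c2: "c2 > 0" and k1: "k1 > 0" and k2: "k2 > 0"
  shows "\<exists>u v. shifted_equilibrium c1 c2 A1 A2 k1 k2 u v"
proof -
  define B where "B v = c1 * v + A1" for v
  define U where "U v = (sqrt ((B v)\<^sup>2 + 4 * k1) - B v) / 2" for v
  define G where "G v = v * (v + c2 * U v + A2)" for v
  have U_pos: "U v > 0" for v
  proof -
    have "\<bar>B v\<bar> < sqrt ((B v)\<^sup>2 + 4 * k1)"
      using k1 by (intro real_less_rsqrt) auto
    then show ?thesis
      unfolding U_def by simp
  qed
  have U_root: "U v * (U v + B v) = k1" for v
  proof -
    have "(sqrt ((B v)\<^sup>2 + 4 * k1))\<^sup>2 = (B v)\<^sup>2 + 4 * k1"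
      using k1 by simp
    then show ?thesis
      unfolding U_def by (simp add: field_simps power2_eq_square)
  qed
  \<comment> \<open>Chosen so that \<open>V \<ge> 1\<close> and \<open>V + A2 \<ge> k2 + 1\<close>,
    whence \<open>G V \<ge> k2\<close>.\<close>
  define V where "V = \<bar>A2\<bar> + k2 + 1"
  have V: "V \<ge> 1"
    unfolding V_def using k2 by simp
  have "k2 \<le> 1 * (k2 + 1)"
    by simp
  also have "\<dots> \<le> G V"
    unfolding G_def
  proof (intro mult_mono)
    have "c2 * U V > 0"
      using c2 U_pos by simp
    then show "k2 + 1 \<le> V + c2 * U V + A2"
      unfolding V_def by linarith
  qed (use V k2 in auto)
  finally have "k2 \<le> G V" .
  moreover have "G 0 \<le> k2"
    using k2 by (simp add: G_def)
  moreover have "continuous_on {0..V} G"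
    unfolding G_def U_def B_def by (intro continuous_intros) auto
  ultimately obtain v where v: "0 \<le> v" "G v = k2"
    using IVT'[of G 0 k2 V] V by auto
  \<comment> \<open>The endpoint is excluded because \<open>G 0 = 0 < k2\<close>.\<close>
  have "v \<noteq> 0"
    using v k2 by (auto simp: G_def)
  then have "shifted_equilibrium c1 c2 A1 A2 k1 k2 (U v) v"
    using v U_pos[of v] U_root[of v]
    unfolding shifted_equilibrium_def G_def B_def by (simp add: algebra_simps)
  then show ?thesis
    by blast
qed

lemma shifted_equilibrium_fst_not_less:
  fixes c1 c2 A1 A2 k1 k2 :: real
  assumes c1: "c1 > 0" and c2: "c2 > 0" and k1: "k1 > 0" and k2: "k2 > 0"
    and cond: "A1 \<ge> 0 \<and> A2 \<ge> 0 \<or> c1 * c2 \<le> 1"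
    and e: "shifted_equilibrium c1 c2 A1 A2 k1 k2 u v"
    and e': "shifted_equilibrium c1 c2 A1 A2 k1 k2 u' v'"
  shows "\<not> u < u'"
proof
  assume less: "u < u'"
  have pos: "u > 0" "v > 0" "u' > 0" "v' > 0"
    using e e' by (auto simp: shifted_equilibrium_def)
  \<comment> \<open>After division the left sides are linear and the right sides strictly decreasing
    in one unknown, so differences can be compared.\<close>
  have quot: "u + c1 * v + A1 = k1 / u" "v + c2 * u + A2 = k2 / v"
    "u' + c1 * v' + A1 = k1 / u'" "v' + c2 * u' + A2 = k2 / v'"
    using e e' by (auto simp: shifted_equilibrium_def field_simps)
  have "k1 / u' < k1 / u"
    using less pos k1 by (intro divide_strict_left_mono) auto
  then have p: "u' - u < c1 * (v - v')"
    using quot by (simp add: algebra_simps)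
  then have less': "v' < v"
    using less c1 by (smt (verit) mult_nonneg_nonpos)
  then have "k2 / v < k2 / v'"
    using pos k2 by (intro divide_strict_left_mono) auto
  then have q: "v - v' < c2 * (u' - u)"
    using quot by (simp add: algebra_simps)
  show False
    using cond
  proof
    assume A: "A1 \<ge> 0 \<and> A2 \<ge> 0"
    have "u * u < u' * u'" "A1 * u \<le> A1 * u'"
      using A pos less by (auto intro!: mult_strict_mono mult_left_mono)
    moreover have "u * u + c1 * (u * v) + A1 * u = u' * u' + c1 * (u' * v') + A1 * u'"
      using e e' by (simp add: shifted_equilibrium_def algebra_simps)
    ultimately have "c1 * (u' * v') < c1 * (u * v)"
      by linarith
    then have "u' * v' < u * v"
      using c1 by simp
    have "v' * v' < v * v" "A2 * v' \<le> A2 * v"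
      using A pos less' by (auto intro!: mult_strict_mono mult_left_mono)
    moreover have "v * v + c2 * (u * v) + A2 * v = v' * v' + c2 * (u' * v') + A2 * v'"
      using e e' by (simp add: shifted_equilibrium_def algebra_simps)
    ultimately have "c2 * (u * v) < c2 * (u' * v')"
      by linarith
    then have "u * v < u' * v'"
      using c2 by simp
    then show False
      using \<open>u' * v' < u * v\<close> by simp
  next
    assume c: "c1 * c2 \<le> 1"
    have "u' - u < c1 * (v - v')"
      by (fact p)
    also have "\<dots> < c1 * (c2 * (u' - u))"
      using q c1 by simp
    also have "\<dots> = (c1 * c2) * (u' - u)"
      by simp
    also have "\<dots> \<le> 1 * (u' - u)"
      using c less by (intro mult_right_mono) auto
    finally show False
      by simp
  qed
qed

text \<open>Exchanging the two solutions gives \<open>u = u'\<close>; the first equation then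
  determines \<open>v\<close>, since \<open>u\<close> and \<open>c1\<close> are nonzero.\<close>

lemma shifted_equilibrium_unique:
  fixes c1 c2 A1 A2 k1 k2 :: real
  assumes "c1 > 0" "c2 > 0" "k1 > 0" "k2 > 0"
    and "A1 \<ge> 0 \<and> A2 \<ge> 0 \<or> c1 * c2 \<le> 1"
    and e: "shifted_equilibrium c1 c2 A1 A2 k1 k2 u v"
    and e': "shifted_equilibrium c1 c2 A1 A2 k1 k2 u' v'"
  shows "u = u' \<and> v = v'"
proof -
  have "\<not> u < u'" "\<not> u' < u"
    using assms shifted_equilibrium_fst_not_less by blast+
  then have u: "u = u'"
    by simp
  have "u * (u + c1 * v + A1) = u * (u + c1 * v' + A1)" "u > 0"
    using e e' u by (auto simp: shifted_equilibrium_def)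
  then show ?thesis
    using u \<open>c1 > 0\<close> by simp
qed

theorem theorem5:
  fixes b1 b2 c1 c2 h1 h2 :: real
  assumes "b1 > 0" "b2 > 0" "c1 > 0" "c2 > 0" "h1 > 0" "h2 > 0"
    and "(1 - b1 + h1 + c1 * h2 \<ge> 0 \<and> 1 - b2 + h2 + c2 * h1 \<ge> 0) \<or> c1 * c2 \<le> 1"
  shows "\<exists>!p. equilibrium b1 b2 c1 c2 h1 h2 p"
proof -
  let ?S = "shifted_equilibrium c1 c2 (1 - b1 + h1 + c1 * h2) (1 - b2 + h2 + c2 * h1)
    (b1 * h1) (b2 * h2)"
  have k: "b1 * h1 > 0" "b2 * h2 > 0"
    using assms by simp_all
  have iff: "equilibrium b1 b2 c1 c2 h1 h2 (x, y) \<longleftrightarrow> ?S (x - h1) (y - h2)" for x y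
    using assms by (intro equilibrium_iff_shifted)
  obtain u v where uv: "?S u v"
    using shifted_equilibrium_exists \<open>c2 > 0\<close> k by blast
  show ?thesis
  proof (rule ex1I)
    show "equilibrium b1 b2 c1 c2 h1 h2 (u + h1, v + h2)"
      using uv by (simp add: iff)
    show "p = (u + h1, v + h2)" if p: "equilibrium b1 b2 c1 c2 h1 h2 p" for p
    proof (cases p)
      case (Pair x y)
      then have "?S (x - h1) (y - h2)"
        using p iff by simp
      then have "x - h1 = u \<and> y - h2 = v"
        using shifted_equilibrium_unique[OF assms(3,4) k assms(7) _ uv] by blast
      then show ?thesis
        using Pair by auto
    qed
  qed
qed

end
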